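(* Let $m,k\geq 3$ be integers, and let $C(m,k)$ be the caterpillar with spine $v_1v_2\dots v_m$ in which every inner spine vertex has degree $k$. Then $$hc(C(m,k))=\begin{cases}(m-2)^2k^2-\frac12(5m^2-20m+19)k+\frac12(3m^2-12m+11), & \text{if } m\text{ is odd},\\[4pt] (m-2)^2k^2-\frac12(5m^2-20m+20)k+\frac12(3m^2-12m+12), & \text{if } m\text{ is even}.\end{cases}$$
   Context: For a connected graph $G$ of order $n$ (finite, simple), $D(u,v)$ denotes the detour distance between vertices $u,v$, i.e. the length of a longest $u,v$-path in $G$ (for a tree this is the ordinary distance). A hamiltonian coloring of $G$ is a map $c: V(G)\to\{0,1,2,\dots\}$ such that $D(u,v)+|c(u)-c(v)|\geq n-1$ for every two distinct vertices $u,v$. The value $hc(c)$ is the maximum color assigned by $c$, and the hamiltonian chromatic number $hc(G)$ is the minimum of $hc(c)$ over all hamiltonian colorings $c$ of $G$ (note that the color $0$ is allowed). A caterpillar is a tree consisting of a path $v_1v_2\dots v_m$ ($m\geq 3$), called the spine, together with some hanging (pendant) edges, called legs, incident to the inner vertices $v_2,\dots,v_{m-1}$. If every $v_i$ with $2\leq i\leq m-1$ has degree $k$ (so exactly $k-2$ pendant vertices are attached to each inner spine vertex), the caterpillar is denoted $C(m,k)$. *)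

theory Defs
  imports Complex_Main "Graph_Theory.Graph_Theory"
begin

text \<open>
  Finite simple graphs are symmetric loop-free finite pair digraphs (locale \<open>pair_graph\<close>):
  an edge is the two opposite arcs between its ends, so the degree of a vertex is its
  \<open>out_degree\<close>. A simple path is an \<open>apath\<close>; its length is its number of arcs.
\<close>

text \<open>Meaningful for connected finite \<open>G\<close>, where the set is finite and nonempty.\<close>

definition detour_distance :: "'a pair_pre_digraph \<Rightarrow> 'a \<Rightarrow> 'a \<Rightarrow> nat" where
  "detour_distance G u w = Max {length p | p. pre_digraph.apath G u p w}"

definition hamiltonian_coloring :: "'a pair_pre_digraph \<Rightarrow> ('a \<Rightarrow> nat) \<Rightarrow> bool" where
  "hamiltonian_coloring G c \<longleftrightarrow>
     (\<forall>u\<in>pverts G. \<forall>w\<in>pverts G. u \<noteq> w \<longrightarrow>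
        int (detour_distance G u w) + \<bar>int (c u) - int (c w)\<bar> \<ge> int (card (pverts G)) - 1)"

definition max_color :: "'a pair_pre_digraph \<Rightarrow> ('a \<Rightarrow> nat) \<Rightarrow> nat" where
  "max_color G c = Max (c ` pverts G)"

definition hamiltonian_chromatic_number :: "'a pair_pre_digraph \<Rightarrow> nat" where
  "hamiltonian_chromatic_number G =
     (LEAST h. \<exists>c. hamiltonian_coloring G c \<and> max_color G c = h)"

text \<open>
  The vertices \<open>v 1, \<dots>, v m\<close> induce a path, and each further vertex is pendant with its
  only neighbour an inner spine vertex. These conditions force \<open>G\<close> to be a tree. (The library
  predicate \<open>tree\<close> cannot be used here: it regards a pair of opposite arcs as a cycle.)
\<close>

definition caterpillar :: "'a pair_pre_digraph \<Rightarrow> nat \<Rightarrow> (nat \<Rightarrow> 'a) \<Rightarrow> bool" where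
  "caterpillar G m v \<longleftrightarrow>
     pair_graph G \<and> m \<ge> 3 \<and>
     inj_on v {1..m} \<and> v ` {1..m} \<subseteq> pverts G \<and>
     (\<forall>i\<in>{1..m}. \<forall>j\<in>{1..m}. (v i, v j) \<in> parcs G \<longleftrightarrow> j = i + 1 \<or> i = j + 1) \<and>
     (\<forall>w\<in>pverts G - v ` {1..m}. \<exists>i\<in>{2..m-1}. \<forall>u. (w, u) \<in> parcs G \<longleftrightarrow> u = v i)"

text \<open>\<open>G\<close> is (a copy of) \<open>C(m,k)\<close> with spine \<open>v 1, \<dots>, v m\<close>.\<close>

definition regular_caterpillar ::
    "'a pair_pre_digraph \<Rightarrow> nat \<Rightarrow> nat \<Rightarrow> (nat \<Rightarrow> 'a) \<Rightarrow> bool" where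
  "regular_caterpillar G m k v \<longleftrightarrow>
     caterpillar G m v \<and> (\<forall>i\<in>{2..m-1}. out_degree G (v i) = k)"

lemma hamiltonian_coloring_exists:
  fixes G :: "'a pair_pre_digraph"
  assumes "finite (pverts G)"
  shows "\<exists>c. hamiltonian_coloring G c"
proof -
  let ?n = "card (pverts G)"
  obtain f :: "'a \<Rightarrow> nat" where f: "inj_on f (pverts G)"
    using finite_imp_inj_to_nat_seg[OF assms] by blast
  have "int ?n \<le> \<bar>int (?n * f u) - int (?n * f w)\<bar>"
    if "u \<in> pverts G" "w \<in> pverts G" "u \<noteq> w" for u w
  proof -
    have "f u \<noteq> f w" using f that by (meson inj_onD)
    hence "1 \<le> \<bar>int (f u) - int (f w)\<bar>" by linarith
    hence "int ?n * 1 \<le> int ?n * \<bar>int (f u) - int (f w)\<bar>"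
      by (intro mult_left_mono) auto
    also have "\<dots> = \<bar>int (?n * f u) - int (?n * f w)\<bar>"
      by (simp add: abs_mult flip: right_diff_distrib)
    finally show ?thesis by simp
  qed
  hence "hamiltonian_coloring G (\<lambda>x. ?n * f x)"
    unfolding hamiltonian_coloring_def by fastforce
  thus ?thesis by blast
qed

lemma regular_caterpillar_exists:
  assumes "m \<ge> 3" "k \<ge> 2"
  shows "\<exists>(G :: (nat \<times> nat) pair_pre_digraph) v. regular_caterpillar G m k v"
proof -
  define v :: "nat \<Rightarrow> nat \<times> nat" where "v = (\<lambda>i. (i, 0))"
  define L where "L = {2..m-1} \<times> {1..k-2}"
  define A where "A = (\<lambda>i. (v i, v (i + 1))) ` {1..m-1} \<union> (\<lambda>x. (v (fst x), x)) ` L"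
  define G where "G = \<lparr> pverts = v ` {1..m} \<union> L, parcs = A \<union> A\<inverse> \<rparr>"
  have fin: "finite (pverts G)" "finite (parcs G)" by (auto simp: G_def A_def L_def)
  have "pair_graph G"
  proof
    show "fst e \<in> pverts G" "snd e \<in> pverts G" if "e \<in> parcs G" for e
      using that assms by (auto simp: G_def A_def L_def v_def)
    show "finite (pverts G)" "finite (parcs G)" by (fact fin)+
    show "fst e \<noteq> snd e" if "e \<in> parcs G" for e
      using that by (auto simp: G_def A_def L_def v_def)
    show "symmetric G" by (auto simp: symmetric_def G_def sym_def)
  qed
  moreover have "(v i, v j) \<in> parcs G \<longleftrightarrow> j = i + 1 \<or> i = j + 1"
    if "i \<in> {1..m}" "j \<in> {1..m}" for i j
    using that by (auto simp: G_def A_def L_def v_def image_iff)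
  moreover have "\<exists>i\<in>{2..m-1}. \<forall>u. (w, u) \<in> parcs G \<longleftrightarrow> u = v i"
    if "w \<in> pverts G - v ` {1..m}" for w
    by (rule bexI[of _ "fst w"]) (use that in \<open>auto simp: G_def A_def L_def v_def image_iff\<close>)
  moreover have "out_degree G (v i) = k" if i: "i \<in> {2..m-1}" for i
  proof -
    have "out_arcs G (v i) =
        {(v i, v (i - 1)), (v i, v (i + 1))} \<union> (\<lambda>j. (v i, (i, j))) ` {1..k-2}"
    proof -
      have "\<exists>j\<in>{Suc 0..m - Suc 0}. i = Suc j \<and> i - Suc 0 = j"
        using i by (intro bexI[of _ "i - 1"]) auto
      thus ?thesis
        using i by (auto simp: out_arcs_def G_def A_def L_def v_def image_iff)
    qed
    moreover have "card \<dots> = 2 + (k - 2)"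
      using i by (subst card_Un_disjoint) (auto simp: v_def card_image inj_on_def)
    ultimately show ?thesis using assms by (simp add: out_degree_def)
  qed
  ultimately have "regular_caterpillar G m k v"
    using assms unfolding regular_caterpillar_def caterpillar_def
    by (auto simp: inj_on_def v_def G_def)
  thus ?thesis by blast
qed

end

theory Submission
  imports Defs
begin

text \<open>
  The detour distance of a tree is its ordinary distance \<open>d\<close>. Let \<open>g u\<close> be twice the distance from
  \<open>u\<close> to the midpoint of the spine (the midpoint of an edge if \<open>m\<close> is even). Then
  \<open>2 * d u w \<le> g u + g w\<close>, with equality if \<open>u\<close> and \<open>w\<close> lie on different sides of the midpoint.
  Listing the \<open>n\<close> vertices by increasing color and adding up the gaps
  \<open>n - 1 - d\<close> between neighbors in the list shows that the span is at least
  \<open>(n - 1)\<^sup>2 - (\<Sum>u. g u) + 1\<close>, since the two ends of the list have total weight at least 2.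
  An ordering that starts next to the midpoint, alternates between the two sides and ends with
  total weight 2 attains the bound; as the diameter \<open>m - 1\<close> is at most \<open>n / 2\<close>, vertices that
  are not neighbors in this ordering impose no further condition.
\<close>

section \<open>Orderings of the vertices and the colorings they induce\<close>

lemma sum_consecutive_pairs:
  fixes a :: "nat \<Rightarrow> int"
  shows "(\<Sum>i<n. a i + a (Suc i)) = 2 * (\<Sum>i\<le>n. a i) - a 0 - a n"
  by (induction n) auto

text \<open>Every vertex inside the ordering belongs to two consecutive pairs and each end to one.
  The total therefore depends on the ordering only through its two ends.\<close>

lemma sum_gaps:
  fixes a :: "'a \<Rightarrow> int"
  assumes "bij_betw x {..n} V"
  shows "(\<Sum>i<n. 2 * int n - (a (x i) + a (x (Suc i))))
    = 2 * (int n)\<^sup>2 - 2 * sum a V + a (x 0) + a (x n)"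
proof -
  have "(\<Sum>i\<le>n. a (x i)) = sum a V"
    using sum.reindex_bij_betw[OF assms] .
  thus ?thesis
    using sum_consecutive_pairs[of "\<lambda>i. a (x i)" n]
    by (simp add: sum_subtractf power2_eq_square)
qed

lemma sorted_enumeration:
  fixes c :: "'a \<Rightarrow> 'b::linorder"
  assumes "finite V" "card V = Suc n"
  obtains x where "bij_betw x {..n} V" "\<And>i. i < n \<Longrightarrow> c (x i) \<le> c (x (Suc i))"
proof -
  obtain ys where ys: "set ys = V" "distinct ys"
    using finite_distinct_list[OF assms(1)] by blast
  define xs where "xs = sort_key c ys"
  have xs: "set xs = V" "distinct xs" "length xs = Suc n" "sorted (map c xs)"
    using ys assms(2) by (auto simp: xs_def distinct_card simp flip: distinct_card)
  have "bij_betw ((!) xs) {..n} V"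
    using xs by (intro bij_betw_nth) auto
  moreover have "c (xs ! i) \<le> c (xs ! Suc i)" if "i < n" for i
    using sorted_nth_mono[OF xs(4), of i "Suc i"] that xs(3) by simp
  ultimately show thesis using that by blast
qed

text \<open>In an ordering by color the absolute values disappear and the color differences
  telescope. The constant \<open>s\<close> then bounds the weight of the two ends, which are
  distinct because \<open>n \<ge> 1\<close>.\<close>

lemma hamiltonian_coloring_span_ge:
  fixes G :: "'a pair_pre_digraph" and g :: "'a \<Rightarrow> int"
  assumes fin: "finite (pverts G)" and card: "card (pverts G) = Suc n" and "n \<ge> 1"
    and D: "\<And>u w. u \<in> pverts G \<Longrightarrow> w \<in> pverts G \<Longrightarrow> u \<noteq> w \<Longrightarrow>
      2 * int (detour_distance G u w) \<le> g u + g w"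
    and s: "\<And>u w. u \<in> pverts G \<Longrightarrow> w \<in> pverts G \<Longrightarrow> u \<noteq> w \<Longrightarrow> s \<le> g u + g w"
    and c: "hamiltonian_coloring G c"
  shows "2 * (int n)\<^sup>2 - 2 * sum g (pverts G) + s \<le> 2 * int (max_color G c)"
proof -
  obtain x where x: "bij_betw x {..n} (pverts G)"
    and mono: "\<And>i. i < n \<Longrightarrow> c (x i) \<le> c (x (Suc i))"
    using sorted_enumeration[OF fin card, of c] by blast
  have mem: "x i \<in> pverts G" if "i \<le> n" for i
    using x that by (auto simp: bij_betw_def)
  have neq: "x i \<noteq> x j" if "i \<le> n" "j \<le> n" "i \<noteq> j" for i j
    using x that by (auto simp: bij_betw_def inj_on_def)
  have gap: "2 * int n - (g (x i) + g (x (Suc i)))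
      \<le> 2 * (int (c (x (Suc i))) - int (c (x i)))" if "i < n" for i
  proof -
    have "int (detour_distance G (x i) (x (Suc i))) + \<bar>int (c (x i)) - int (c (x (Suc i)))\<bar> \<ge> int n"
      using c that mem neq card by (auto simp: hamiltonian_coloring_def)
    moreover have "2 * int (detour_distance G (x i) (x (Suc i))) \<le> g (x i) + g (x (Suc i))"
      using that by (intro D mem neq) auto
    moreover have "int (c (x i)) \<le> int (c (x (Suc i)))" using mono[OF that] by simp
    ultimately show ?thesis by simp
  qed
  have "(\<Sum>i<n. 2 * int n - (g (x i) + g (x (Suc i))))
      \<le> (\<Sum>i<n. 2 * (int (c (x (Suc i))) - int (c (x i))))"
    by (intro sum_mono gap) auto
  also have "\<dots> = 2 * (int (c (x n)) - int (c (x 0)))"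
    unfolding sum_distrib_left[symmetric] sum_lessThan_telescope[of "\<lambda>i. int (c (x i))"] ..
  finally have "2 * (int n)\<^sup>2 - 2 * sum g (pverts G) + g (x 0) + g (x n)
      \<le> 2 * (int (c (x n)) - int (c (x 0)))"
    by (simp only: sum_gaps[OF x])
  moreover have "s \<le> g (x 0) + g (x n)"
    using \<open>n \<ge> 1\<close> by (intro s mem neq) auto
  moreover have "int (c (x n)) \<le> int (max_color G c)"
    unfolding max_color_def of_nat_le_iff using fin mem by (intro Max_ge) auto
  ultimately show ?thesis by simp
qed

text \<open>
  Every gap between consecutive colors is at least \<open>n - d\<close>, so two gaps make up at least
  \<open>n - 1\<close>: vertices that are not consecutive satisfy the coloring condition automatically.
\<close>

lemma hamiltonian_coloring_from_enumeration:
  fixes G :: "'a pair_pre_digraph" and g :: "'a \<Rightarrow> int"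
  assumes fin: "finite (pverts G)" and card: "card (pverts G) = Suc n"
    and d: "2 * d \<le> Suc n"
    and D_le: "\<And>u w. u \<in> pverts G \<Longrightarrow> w \<in> pverts G \<Longrightarrow> u \<noteq> w \<Longrightarrow> detour_distance G u w \<le> d"
    and D_ge: "\<And>u w. u \<in> pverts G \<Longrightarrow> w \<in> pverts G \<Longrightarrow> u \<noteq> w \<Longrightarrow> 1 \<le> detour_distance G u w"
    and D_sym: "\<And>u w. u \<in> pverts G \<Longrightarrow> w \<in> pverts G \<Longrightarrow> detour_distance G u w = detour_distance G w u"
    and x: "bij_betw x {..n} (pverts G)"
    and D: "\<And>i. i < n \<Longrightarrow> 2 * int (detour_distance G (x i) (x (Suc i))) = g (x i) + g (x (Suc i))"
  obtains c where "hamiltonian_coloring G c"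
    "2 * int (max_color G c) = 2 * (int n)\<^sup>2 - 2 * sum g (pverts G) + g (x 0) + g (x n)"
proof -
  define D' where "D' = detour_distance G"
  have mem: "x i \<in> pverts G" if "i \<le> n" for i
    using x that by (auto simp: bij_betw_def)
  have inj: "inj_on x {..n}" using x by (auto simp: bij_betw_def)
  have neq: "x i \<noteq> x j" if "i \<le> n" "j \<le> n" "i \<noteq> j" for i j
    using inj that by (auto simp: inj_on_def)
  \<comment> \<open>The least admissible color difference for consecutive vertices. The subtraction
    does not truncate for \<open>i < n\<close>: distances are at most \<open>d\<close>, and
    \<open>2 * d \<le> Suc n\<close> gives \<open>d \<le> n\<close> when
    \<open>n \<ge> 1\<close>.\<close>
  define gap where "gap = (\<lambda>i. n - D' (x i) (x (Suc i)))"
  define S where "S = (\<lambda>j. \<Sum>i<j. gap i)"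
  define c where "c = (\<lambda>u. S (inv_into {..n} x u))"
  have c_x: "c (x i) = S i" if "i \<le> n" for i
    using that inj by (simp add: c_def)
  have step_D: "D' (x i) (x (Suc i)) \<le> d" if "i < n" for i
    unfolding D'_def using that by (intro D_le mem neq) auto
  have S_mono: "S i \<le> S j" if "i \<le> j" for i j
    unfolding S_def using that by (intro sum_mono2) auto
  have far: "n \<le> D' (x i) (x j) + (S j - S i)" if "i < j" "j \<le> n" for i j
  proof (cases "j = Suc i")
    case True
    thus ?thesis by (simp add: S_def gap_def)
  next
    case False
    hence "S (Suc (Suc i)) \<le> S j" using that by (intro S_mono) auto
    moreover have "n - d \<le> gap i" "n - d \<le> gap (Suc i)"
      using step_D[of i] step_D[of "Suc i"] that False by (auto simp: gap_def)
    hence "S i + 2 * (n - d) \<le> S (Suc (Suc i))" by (simp add: S_def)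
    \<comment> \<open>Two gaps only guarantee a color difference of \<open>n - 1\<close>; the
      missing 1 comes from the distance itself.\<close>
    moreover have "1 \<le> D' (x i) (x j)"
      unfolding D'_def using that by (intro D_ge mem neq) auto
    ultimately show ?thesis using d by linarith
  qed
  have "int n \<le> int (D' u w) + \<bar>int (c u) - int (c w)\<bar>"
    if uw: "u \<in> pverts G" "w \<in> pverts G" "u \<noteq> w" for u w
  proof -
    obtain i j where ij: "i \<le> n" "u = x i" "j \<le> n" "w = x j"
      using uw x unfolding bij_betw_def by blast
    consider "i < j" | "j < i" using ij uw by fastforce
    thus ?thesis
    proof cases
      case 1
      thus ?thesis using far[of i j] S_mono[of i j] ij by (simp add: c_x)
    next
      case 2
      thus ?thesis using far[of j i] S_mono[of j i] ij uw D_sym[of u w]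
        by (simp add: c_x D'_def)
    qed
  qed
  hence "hamiltonian_coloring G c"
    using card by (auto simp: hamiltonian_coloring_def D'_def)
  moreover have "max_color G c = S n"
  proof -
    have "c ` pverts G = S ` {..n}"
      using x by (force simp: bij_betw_def c_x)
    moreover have "Max (S ` {..n}) = S n"
      using S_mono by (intro Max_eqI) auto
    ultimately show ?thesis by (simp add: max_color_def)
  qed
  moreover have "2 * int (S n) = (\<Sum>i<n. 2 * int n - (g (x i) + g (x (Suc i))))"
  proof -
    have "2 * int (gap i) = 2 * int n - (g (x i) + g (x (Suc i)))" if "i < n" for i
      using step_D[OF that] D[OF that] d that by (simp add: gap_def D'_def)
    thus ?thesis by (simp add: S_def sum_distrib_left)
  qed
  ultimately show thesis using that[of c] sum_gaps[OF x, of g] by simp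
qed

text \<open>The ordering \<open>xs\<close> attains the lower bound: consecutive vertices meet the
  weight bound with equality, and the two ends have the least weight among all pairs, so their
  weight serves as \<open>s\<close>.\<close>

lemma hamiltonian_chromatic_number_eqI:
  fixes G :: "'a pair_pre_digraph" and g :: "'a \<Rightarrow> int"
  assumes "finite (pverts G)" "card (pverts G) = Suc n" "2 * d \<le> Suc n" "n \<ge> 1"
    and "\<And>u w. u \<in> pverts G \<Longrightarrow> w \<in> pverts G \<Longrightarrow> u \<noteq> w \<Longrightarrow> detour_distance G u w \<le> d"
    and "\<And>u w. u \<in> pverts G \<Longrightarrow> w \<in> pverts G \<Longrightarrow> u \<noteq> w \<Longrightarrow> 1 \<le> detour_distance G u w"
    and "\<And>u w. u \<in> pverts G \<Longrightarrow> w \<in> pverts G \<Longrightarrow> detour_distance G u w = detour_distance G w u"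
    and "\<And>u w. u \<in> pverts G \<Longrightarrow> w \<in> pverts G \<Longrightarrow> u \<noteq> w \<Longrightarrow>
      2 * int (detour_distance G u w) \<le> g u + g w"
    and "\<And>u w. u \<in> pverts G \<Longrightarrow> w \<in> pverts G \<Longrightarrow> u \<noteq> w \<Longrightarrow> g (hd xs) + g (last xs) \<le> g u + g w"
    and xs: "distinct xs" "set xs = pverts G"
    and D: "successively (\<lambda>u w. 2 * int (detour_distance G u w) = g u + g w) xs"
  shows "2 * int (hamiltonian_chromatic_number G)
    = 2 * (int n)\<^sup>2 - 2 * sum g (pverts G) + g (hd xs) + g (last xs)"
proof -
  have len: "length xs = Suc n"
    using distinct_card[OF xs(1)] xs(2) assms(2) by simp
  hence "xs \<noteq> []" by auto
  hence ends: "hd xs = xs ! 0" "last xs = xs ! n"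
    by (simp_all add: hd_conv_nth last_conv_nth len)
  have bij: "bij_betw ((!) xs) {..n} (pverts G)"
    using xs len by (intro bij_betw_nth) auto
  obtain c where c: "hamiltonian_coloring G c"
    "2 * int (max_color G c) = 2 * (int n)\<^sup>2 - 2 * sum g (pverts G) + g (hd xs) + g (last xs)"
    unfolding ends
    by (rule hamiltonian_coloring_from_enumeration[OF assms(1,2,3,5-7) bij])
      (use D len in \<open>auto simp: successively_conv_nth\<close>)
  have "hamiltonian_chromatic_number G = max_color G c"
    unfolding hamiltonian_chromatic_number_def
  proof (rule Least_equality)
    fix h assume "\<exists>c. hamiltonian_coloring G c \<and> max_color G c = h"
    then obtain c' where c': "hamiltonian_coloring G c'" "max_color G c' = h" by blast
    have "2 * (int n)\<^sup>2 - 2 * sum g (pverts G) + (g (hd xs) + g (last xs)) \<le> 2 * int (max_color G c')"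
      by (rule hamiltonian_coloring_span_ge[OF assms(1,2,4,8,9) c'(1)])
    thus "max_color G c \<le> h" using c(2) c'(2) by linarith
  qed (use c(1) in blast)
  thus ?thesis using c(2) by simp
qed

text \<open>Since the lengths agree, the alternation that starts in \<open>As\<close> ends in
  \<open>Bs\<close>, from where \<open>R\<close> leads on to \<open>Cs\<close>. The term
  \<open>hd (As @ Cs)\<close> also covers an empty alternation.\<close>

lemma successively_splice:
  assumes "length As = length Bs" "R w (hd (As @ Cs))" "Cs \<noteq> []"
    and "\<And>a b. a \<in> set As \<Longrightarrow> b \<in> set Bs \<Longrightarrow> R a b \<and> R b a"
    and "\<And>b c. b \<in> set Bs \<Longrightarrow> c \<in> set Cs \<Longrightarrow> R b c"
    and "successively R Cs"
  shows "successively R (w # splice As Bs @ Cs)"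
  using assms
proof (induction As Bs arbitrary: w rule: list_induct2)
  case (Cons a As b Bs)
  have "successively R (b # splice As Bs @ Cs)"
    using Cons.prems by (intro Cons.IH) (cases As; auto)+
  thus ?case using Cons.prems by auto
qed (auto simp: successively_Cons)

section \<open>Paths and distances in a caterpillar\<close>

text \<open>The walk has to use some arc out of \<open>S\<close>, and all of these end in
  \<open>y\<close>.\<close>

lemma (in pair_wf_digraph) awalk_exit:
  assumes "awalk x p w" "x \<in> S" "w \<notin> S"
    and "\<And>a b. (a, b) \<in> parcs G \<Longrightarrow> a \<in> S \<Longrightarrow> b \<notin> S \<Longrightarrow> b = y"
  shows "y \<in> set (awalk_verts x p)"
  using assms(1,2)
proof (induction p arbitrary: x)
  case Nil
  thus ?case using assms(3) by (auto simp: awalk_Nil_iff)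
next
  case (Cons e p)
  from Cons.prems(1) have e: "e \<in> parcs G" "fst e = x" "awalk (snd e) p w"
    by (auto simp: awalk_Cons_iff)
  show ?case
  proof (cases "snd e \<in> S")
    case True
    thus ?thesis using Cons.IH e by auto
  next
    case False
    hence "snd e = y" using assms(4)[of "fst e" "snd e"] e Cons.prems(2) by auto
    moreover have "snd e \<in> set (awalk_verts (snd e) p)" by (cases p) (use e in auto)
    ultimately show ?thesis by auto
  qed
qed

locale caterpillar_graph =
  fixes G :: "'a pair_pre_digraph" and m :: nat and v :: "nat \<Rightarrow> 'a"
  assumes caterpillar: "caterpillar G m v"

sublocale caterpillar_graph \<subseteq> pair_graph G
  using caterpillar by (simp add: caterpillar_def)

context caterpillar_graph
begin

definition spine :: "'a set" where
  "spine = v ` {1..m}"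

text \<open>A leg gets the position of the spine vertex from which it hangs.\<close>

definition pos :: "'a \<Rightarrow> nat" where
  "pos u = (if u \<in> spine then inv_into {1..m} v u
    else SOME i. i \<in> {2..m-1} \<and> (\<forall>x. (u, x) \<in> parcs G \<longleftrightarrow> x = v i))"

definition leg :: "'a \<Rightarrow> nat" where
  "leg u = (if u \<in> spine then 0 else 1)"

text \<open>The route goes from \<open>u\<close> to the spine, along it, and out to
  \<open>w\<close>. The case \<open>u = w\<close> is separate because the formula would give 2 for a
  leg.\<close>

definition tree_dist :: "'a \<Rightarrow> 'a \<Rightarrow> int" where
  "tree_dist u w = (if u = w then 0 else \<bar>int (pos u) - int (pos w)\<bar> + int (leg u) + int (leg w))"

lemma m_ge_3: "m \<ge> 3"
  and inj_v: "inj_on v {1..m}"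
  and spine_subset: "spine \<subseteq> pverts G"
  and v_arc_iff: "\<lbrakk>i \<in> {1..m}; j \<in> {1..m}\<rbrakk> \<Longrightarrow> (v i, v j) \<in> parcs G \<longleftrightarrow> j = i + 1 \<or> i = j + 1"
  using caterpillar by (auto simp: caterpillar_def spine_def)

lemma pos_v [simp]: "i \<in> {1..m} \<Longrightarrow> pos (v i) = i"
  using inj_v by (auto simp: pos_def spine_def)

lemma leg_v [simp]: "i \<in> {1..m} \<Longrightarrow> leg (v i) = 0"
  by (auto simp: leg_def spine_def)

lemma v_in_spine [simp]: "i \<in> {1..m} \<Longrightarrow> v i \<in> spine"
  by (auto simp: spine_def)

lemma v_in_verts [simp]: "i \<in> {1..m} \<Longrightarrow> v i \<in> pverts G"
  using spine_subset v_in_spine by blast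

lemma v_pos: "u \<in> spine \<Longrightarrow> v (pos u) = u"
  by (auto simp: spine_def)

lemma
  assumes "u \<in> pverts G" "u \<notin> spine"
  shows leg_pos: "pos u \<in> {2..m-1}"
    and leg_arc_iff: "(u, x) \<in> parcs G \<longleftrightarrow> x = v (pos u)"
proof -
  define P where "P = (\<lambda>i. i \<in> {2..m-1} \<and> (\<forall>x. (u, x) \<in> parcs G \<longleftrightarrow> x = v i))"
  have "\<exists>i. P i"
    using caterpillar assms unfolding caterpillar_def spine_def P_def Bex_def by simp
  moreover have "pos u = (SOME i. P i)"
    using assms(2) by (simp add: pos_def P_def)
  ultimately have "P (pos u)" by (simp only: someI_ex)
  thus "pos u \<in> {2..m-1}" "(u, x) \<in> parcs G \<longleftrightarrow> x = v (pos u)"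
    unfolding P_def by blast+
qed

lemma pos_range:
  assumes "u \<in> pverts G" shows "pos u \<in> {1..m}"
proof (cases "u \<in> spine")
  case True
  thus ?thesis by (auto simp: spine_def)
next
  case False
  thus ?thesis using leg_pos[OF assms] by auto
qed

text \<open>The only neighbor of a leg lies on the spine, so no arc joins two legs, and spine
  vertices are adjacent only if consecutive.\<close>

lemma arc_cases [consumes 1, case_names right left to_leg from_leg]:
  assumes "(a, b) \<in> parcs G"
  obtains i where "1 \<le> i" "i < m" "a = v i" "b = v (Suc i)"
  | i where "1 \<le> i" "i < m" "a = v (Suc i)" "b = v i"
  | "b \<in> pverts G" "b \<notin> spine" "a = v (pos b)" "pos b \<in> {1..m}"
  | "a \<in> pverts G" "a \<notin> spine" "b = v (pos a)" "pos a \<in> {1..m}"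
proof -
  have ab: "a \<in> pverts G" "b \<in> pverts G" using in_arcsD1[OF assms] in_arcsD2[OF assms] by auto
  consider "a \<notin> spine" | "b \<notin> spine" | "a \<in> spine" "b \<in> spine" by blast
  thus thesis
  proof cases
    case 1
    thus ?thesis using that(4) ab assms leg_arc_iff pos_range by blast
  next
    case 2
    thus ?thesis using that(3) ab arcs_symmetric[OF assms] leg_arc_iff pos_range by blast
  next
    case 3
    then obtain i j where ij: "i \<in> {1..m}" "j \<in> {1..m}" "a = v i" "b = v j"
      by (auto simp: spine_def)
    hence "j = Suc i \<or> i = Suc j" using v_arc_iff assms by auto
    thus ?thesis using that(1)[of i] that(2)[of j] ij by auto
  qed
qed

text \<open>
  A step of a path decreases the distance to \<open>w\<close> unless \<open>u\<close> separates \<open>u'\<close> from \<open>w\<close>, which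
  is impossible on a path that does not return to \<open>u\<close>; \<open>S\<close> is then the component of \<open>u'\<close>
  after removal of the edge.
\<close>

lemma tree_dist_step:
  assumes "(u, u') \<in> parcs G" "w \<in> pverts G" "w \<noteq> u"
    and none: "\<And>S. u' \<in> S \<Longrightarrow> w \<notin> S \<Longrightarrow>
      (\<And>a b. (a, b) \<in> parcs G \<Longrightarrow> a \<in> S \<Longrightarrow> b \<notin> S \<Longrightarrow> b = u) \<Longrightarrow> False"
  shows "tree_dist u w = tree_dist u' w + 1"
  using assms(1)
proof (cases rule: arc_cases)
  case (right i)
  have "pos w \<ge> Suc i"
  proof (rule ccontr)
    assume "\<not> pos w \<ge> Suc i"
    show False
    proof (rule none[of "{x. pos x \<ge> Suc i}"])
      fix a b assume "(a, b) \<in> parcs G" and ab: "a \<in> {x. pos x \<ge> Suc i}" "b \<notin> {x. pos x \<ge> Suc i}"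
      thus "b = u"
      proof (cases rule: arc_cases)
        case left': (left j)
        hence "j = i" using ab right by simp
        thus ?thesis using left' right by simp
      qed (use ab right in auto)
    qed (use right \<open>\<not> pos w \<ge> Suc i\<close> in auto)
  qed
  \<comment> \<open>If \<open>w = u'\<close>, then \<open>tree_dist u' w\<close> is 0 by its special
    case, so \<open>tree_dist u w = 1\<close> has to be checked separately.\<close>
  moreover have "leg w = 0" if "w = v (Suc i)" using that right by simp
  ultimately show ?thesis using right \<open>w \<noteq> u\<close> by (auto simp: tree_dist_def)
next
  case (left i)
  have "pos w \<le> i"
  proof (rule ccontr)
    assume "\<not> pos w \<le> i"
    show False
    proof (rule none[of "{x. pos x \<le> i}"])
      fix a b assume "(a, b) \<in> parcs G" "a \<in> {x. pos x \<le> i}" "b \<notin> {x. pos x \<le> i}"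
      thus "b = u" by (cases rule: arc_cases) (use left in \<open>auto simp: le_less_Suc_eq not_less_eq_eq\<close>)
    qed (use left \<open>\<not> pos w \<le> i\<close> in auto)
  qed
  thus ?thesis using left \<open>w \<noteq> u\<close> by (auto simp: tree_dist_def)
next
  case to_leg
  \<comment> \<open>A leg is a dead end: cutting its edge isolates it, so a path that steps onto it
    must end there.\<close>
  have "w = u'"
  proof (rule ccontr)
    assume "w \<noteq> u'"
    show False
    proof (rule none[of "{u'}"])
      fix a b assume "(a, b) \<in> parcs G" "a \<in> {u'}"
      thus "b = u" using leg_arc_iff to_leg by auto
    qed (use \<open>w \<noteq> u'\<close> in auto)
  qed
  thus ?thesis using to_leg \<open>w \<noteq> u\<close> by (auto simp: tree_dist_def leg_def)
next
  case from_leg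
  thus ?thesis using \<open>w \<noteq> u\<close> by (auto simp: tree_dist_def leg_def)
qed

text \<open>Each step of a simple path comes nearer to \<open>w\<close> by exactly one, because by
  \<open>awalk_exit\<close> a set separating \<open>u'\<close> from \<open>w\<close> would force the
  rest of the path back through \<open>u\<close>. Hence all simple paths between two given vertices
  have the same length.\<close>

lemma length_apath_eq_tree_dist:
  assumes "apath u p w"
  shows "int (length p) = tree_dist u w"
  using assms
proof (induction p arbitrary: u)
  case Nil
  thus ?case by (simp add: apath_Nil_iff tree_dist_def)
next
  case (Cons e p)
  define u' where "u' = snd e"
  have e: "(u, u') \<in> parcs G" "apath u' p w" "u \<notin> set (awalk_verts u' p)"
    using Cons.prems by (auto simp: apath_Cons_iff u'_def)
  have walk: "awalk u' p w" using e(2) by (rule awalkI_apath)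
  have "tree_dist u w = tree_dist u' w + 1"
  proof (rule tree_dist_step[OF e(1)])
    show "w \<in> pverts G" using walk by (rule awalk_last_in_verts)
    have "w \<in> set (awalk_verts u' p)"
      using walk last_in_set[of "awalk_verts u' p"] by auto
    thus "w \<noteq> u" using e(3) by blast
    show False if "u' \<in> S" "w \<notin> S"
      "\<And>a b. (a, b) \<in> parcs G \<Longrightarrow> a \<in> S \<Longrightarrow> b \<notin> S \<Longrightarrow> b = u" for S
      using awalk_exit[OF walk that(1,2), of u] that(3) e(3) by blast
  qed
  thus ?case using Cons.IH[OF e(2)] by simp
qed

lemma reachable_spine:
  assumes "i \<in> {1..m}"
  shows "v 1 \<rightarrow>\<^sup>*\<^bsub>G\<^esub> v i"
proof -
  from assms have "1 \<le> i" "i \<le> m" by auto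
  thus ?thesis
  proof (induction i rule: dec_induct)
    case base
    thus ?case using m_ge_3 by (intro reachable_refl) auto
  next
    case (step i)
    have "(v i, v (Suc i)) \<in> parcs G" using step by (subst v_arc_iff) auto
    thus ?case using step by (meson Suc_leD reachable_adj_trans)
  qed
qed

lemma reachable_all:
  assumes "u \<in> pverts G" "w \<in> pverts G"
  shows "u \<rightarrow>\<^sup>*\<^bsub>G\<^esub> w"
proof -
  have "v 1 \<rightarrow>\<^sup>*\<^bsub>G\<^esub> x" if x: "x \<in> pverts G" for x
  proof (cases "x \<in> spine")
    case True
    thus ?thesis using reachable_spine by (auto simp: spine_def)
  next
    case False
    hence "(x, v (pos x)) \<in> parcs G" using leg_arc_iff[OF x] by simp
    hence "(v (pos x), x) \<in> parcs G" by (rule arcs_symmetric)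
    thus ?thesis using reachable_spine[OF pos_range[OF x]] by (meson reachable_adj_trans)
  qed
  from this[OF assms(1)] this[OF assms(2)] show ?thesis
    using symmetric_reachable' by (blast intro: reachable_trans)
qed

text \<open>By connectedness and the equality of all path lengths, the maximum is taken over a
  singleton.\<close>

lemma detour_distance_eq:
  assumes "u \<in> pverts G" "w \<in> pverts G"
  shows "int (detour_distance G u w) = tree_dist u w"
proof -
  obtain p where p: "apath u p w" using reachable_all[OF assms] by (elim reachable_apath[THEN iffD1, THEN exE])
  have "length q = length p" if "apath u q w" for q
    using length_apath_eq_tree_dist[OF that] length_apath_eq_tree_dist[OF p] by simp
  hence "{length q | q. apath u q w} = {length p}"
    using p by blast
  thus ?thesis using length_apath_eq_tree_dist[OF p] by (simp add: detour_distance_def)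
qed

end

section \<open>Alternating orderings and sums around a midpoint\<close>

text \<open>The order is \<open>w\<close>, then \<open>A\<close> and \<open>B\<close> alternately,
  then \<open>C\<close>. Here \<open>A\<close> and \<open>B\<close> stand for the two sides of the
  midpoint and \<open>C\<close> for the central vertices reserved for the end.\<close>

lemma alternating_enumeration:
  assumes fin: "finite A" "finite B" "finite C" and "card A = card B" "C \<noteq> {}"
    and disj: "A \<inter> B = {}" "A \<inter> C = {}" "B \<inter> C = {}" "w \<notin> A \<union> B \<union> C"
    and R: "\<And>a b. a \<in> A \<Longrightarrow> b \<in> B \<Longrightarrow> R a b \<and> R b a" "\<And>b c. b \<in> B \<Longrightarrow> c \<in> C \<Longrightarrow> R b c"
      "\<And>c c'. c \<in> C \<Longrightarrow> c' \<in> C \<Longrightarrow> c \<noteq> c' \<Longrightarrow> R c c'"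
      "\<And>a. a \<in> A \<union> C \<Longrightarrow> R w a"
  shows "\<exists>xs. distinct xs \<and> set xs = insert w (A \<union> B \<union> C) \<and> successively R xs \<and>
    hd xs = w \<and> last xs \<in> C"
proof -
  obtain As Bs Cs where lists: "set As = A" "distinct As" "set Bs = B" "distinct Bs"
    "set Cs = C" "distinct Cs"
    using fin finite_distinct_list by metis
  have len: "length As = length Bs"
    using lists \<open>card A = card B\<close> by (metis distinct_card)
  have ne: "Cs \<noteq> []" using lists \<open>C \<noteq> {}\<close> by auto
  have "splice As Bs \<in> shuffles As Bs" by simp
  hence AB: "set (splice As Bs) = A \<union> B" "distinct (splice As Bs)"
    using lists disj set_shuffles distinct_disjoint_shuffles by metis+
  have "successively R Cs"
    using lists R(3) by (auto simp: successively_conv_nth nth_eq_iff_index_eq)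
  moreover have "hd (As @ Cs) \<in> A \<union> C"
    using ne lists by (cases As) auto
  ultimately have "successively R (w # splice As Bs @ Cs)"
    using len ne lists R by (intro successively_splice) auto
  moreover have "last (w # splice As Bs @ Cs) \<in> C"
    using ne lists by auto
  ultimately show ?thesis
    using AB lists disj by (intro exI[of _ "w # splice As Bs @ Cs"]) auto
qed

text \<open>Adding one position at each end keeps the midpoint and contributes two terms
  \<open>m + 1\<close>, hence the induction in steps of two.\<close>

lemma sum_centered_abs:
  "2 * (\<Sum>i=1..m. \<bar>2 * int i - (int m + 1)\<bar>) = (int m)\<^sup>2 - int (m mod 2)"
proof (induction m rule: induct_nat_012)
  case (ge2 m)
  have "(\<Sum>i=1..Suc (Suc m). \<bar>2 * int i - (int (Suc (Suc m)) + 1)\<bar>)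
      = (\<Sum>i=2..Suc m. \<bar>2 * int i - (int (Suc (Suc m)) + 1)\<bar>) + 2 * (int m + 1)"
    by (simp add: sum.atLeast_Suc_atMost numeral_2_eq_2)
  also have "(\<Sum>i=2..Suc m. \<bar>2 * int i - (int (Suc (Suc m)) + 1)\<bar>)
      = (\<Sum>i=1..m. \<bar>2 * int i - (int m + 1)\<bar>)"
    using sum.shift_bounds_cl_Suc_ivl[of "\<lambda>i. \<bar>2 * int i - (int (Suc (Suc m)) + 1)\<bar>" 1 m]
    by (simp add: numeral_2_eq_2 algebra_simps)
  finally show ?case using ge2(1) by (simp add: power2_eq_square algebra_simps)
qed auto

section \<open>Counts and weights in the regular caterpillar\<close>

locale regular_caterpillar_graph = caterpillar_graph +
  fixes k :: nat
  assumes k: "k \<ge> 3" and regular: "\<And>i. i \<in> {2..m-1} \<Longrightarrow> out_degree G (v i) = k"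
begin

definition legs_at :: "nat \<Rightarrow> 'a set" where
  "legs_at i = {u \<in> pverts G - spine. pos u = i}"

text \<open>Of the \<open>k\<close> neighbors of an inner spine vertex, exactly two lie on the
  spine.\<close>

lemma card_legs_at:
  assumes i: "i \<in> {2..m-1}"
  shows "card (legs_at i) = k - 2"
proof -
  have in_range: "i - 1 \<in> {1..m}" "i \<in> {1..m}" "i + 1 \<in> {1..m}" using i by auto
  have "x \<in> {v (i - 1), v (i + 1)} \<union> legs_at i" if "(v i, x) \<in> parcs G" for x
    using that
  proof (cases rule: arc_cases)
    case (right j)
    hence "i = j" using inj_onD[OF inj_v, of i j] in_range by auto
    thus ?thesis using right by simp
  next
    case (left j)
    hence "i = Suc j" using inj_onD[OF inj_v, of i "Suc j"] in_range by auto
    thus ?thesis using left by simp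
  next
    case to_leg
    hence "i = pos x" using inj_onD[OF inj_v, of i "pos x"] in_range by auto
    thus ?thesis using to_leg by (simp add: legs_at_def)
  qed (use in_range in simp)
  moreover have "(v i, x) \<in> parcs G" if "x \<in> {v (i - 1), v (i + 1)} \<union> legs_at i" for x
    using that i in_range
    by (auto simp: legs_at_def v_arc_iff leg_arc_iff intro: arcs_symmetric)
  ultimately have "out_arcs G (v i) = Pair (v i) ` ({v (i - 1), v (i + 1)} \<union> legs_at i)"
    by (force simp: out_arcs_def)
  moreover have "card (Pair (v i) ` ({v (i - 1), v (i + 1)} \<union> legs_at i))
      = card ({v (i - 1), v (i + 1)} \<union> legs_at i)"
    by (intro card_image inj_onI) simp
  ultimately have "k = card ({v (i - 1), v (i + 1)} \<union> legs_at i)"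
    using regular[OF i] by (simp only: out_degree_def)
  also have "\<dots> = card {v (i - 1), v (i + 1)} + card (legs_at i)"
    using in_range pair_finite_verts by (intro card_Un_disjoint) (auto simp: legs_at_def)
  also have "v (i - 1) \<noteq> v (i + 1)"
    using inj_onD[OF inj_v, of "i - 1" "i + 1"] in_range by auto
  hence "card {v (i - 1), v (i + 1)} = 2" by simp
  finally show ?thesis by simp
qed

text \<open>Reduces the order, the total weight and the sizes of the two sides to sums over
  positions.\<close>

lemma sum_over_verts:
  fixes F :: "nat \<Rightarrow> nat \<Rightarrow> 'b::comm_semiring_1"
  shows "(\<Sum>u\<in>pverts G. F (pos u) (leg u))
    = (\<Sum>i=1..m. F i 0) + of_nat (k - 2) * (\<Sum>i=2..m-1. F i 1)"
proof -
  have verts: "pverts G = spine \<union> (\<Union>i\<in>{2..m-1}. legs_at i)"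
  proof (intro equalityI subsetI)
    fix u assume "u \<in> pverts G"
    thus "u \<in> spine \<union> (\<Union>i\<in>{2..m-1}. legs_at i)"
      using leg_pos[of u] by (auto simp: legs_at_def)
  qed (use spine_subset in \<open>auto simp: legs_at_def\<close>)
  have fin: "finite spine" "finite (legs_at i)" for i
    using pair_finite_verts by (auto simp: spine_def legs_at_def)
  have "(\<Sum>u\<in>pverts G. F (pos u) (leg u))
      = (\<Sum>u\<in>spine. F (pos u) (leg u)) + (\<Sum>u\<in>(\<Union>i\<in>{2..m-1}. legs_at i). F (pos u) (leg u))"
    unfolding verts using fin by (intro sum.union_disjoint) (auto simp: legs_at_def)
  also have "(\<Sum>u\<in>spine. F (pos u) (leg u)) = (\<Sum>i=1..m. F i 0)"
    unfolding spine_def using inj_v by (subst sum.reindex) (auto intro!: sum.cong)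
  also have "(\<Sum>u\<in>(\<Union>i\<in>{2..m-1}. legs_at i). F (pos u) (leg u))
      = (\<Sum>i=2..m-1. \<Sum>u\<in>legs_at i. F (pos u) (leg u))"
    using fin by (intro sum.UNION_disjoint) (auto simp: legs_at_def)
  also have "\<dots> = (\<Sum>i=2..m-1. of_nat (k - 2) * F i 1)"
  proof (intro sum.cong refl)
    fix i assume i: "i \<in> {2..m-1}"
    have "(\<Sum>u\<in>legs_at i. F (pos u) (leg u)) = (\<Sum>u\<in>legs_at i. F i 1)"
      by (intro sum.cong) (auto simp: legs_at_def leg_def)
    thus "(\<Sum>u\<in>legs_at i. F (pos u) (leg u)) = of_nat (k - 2) * F i 1"
      using card_legs_at[OF i] by simp
  qed
  finally show ?thesis by (simp add: sum_distrib_left)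
qed

lemma card_verts: "card (pverts G) = Suc ((m - 2) * (k - 1) + 1)"
proof -
  have "card (pverts G) = m + (k - 2) * (m - 2)"
    using sum_over_verts[of "\<lambda>_ _. 1 :: nat"] m_ge_3 by simp
  moreover have "k - 1 = Suc (k - 2)" using k by simp
  hence "(m - 2) * (k - 1) = (k - 2) * (m - 2) + (m - 2)" by simp
  ultimately show ?thesis using m_ge_3 by linarith
qed

text \<open>
  Distances to the midpoint \<open>(m + 1) / 2\<close> of the spine, doubled to stay integral when \<open>m\<close> is even.
\<close>

definition offset :: "'a \<Rightarrow> int" where
  "offset u = 2 * int (pos u) - (int m + 1)"

definition weight :: "'a \<Rightarrow> int" where
  "weight u = \<bar>offset u\<bar> + 2 * int (leg u)"

text \<open>The triangle inequality through the midpoint of the spine, doubled.\<close>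

lemma tree_dist_le_weight: "2 * tree_dist u w \<le> weight u + weight w"
  unfolding tree_dist_def weight_def offset_def by (simp split: if_splits, arith)

text \<open>The route between the two vertices passes through the midpoint; vertices with offset 0
  count as lying on both sides.\<close>

lemma tree_dist_eq_weight:
  assumes "u \<noteq> w" "offset u \<le> 0 \<and> 0 \<le> offset w \<or> offset w \<le> 0 \<and> 0 \<le> offset u"
  shows "2 * tree_dist u w = weight u + weight w"
  using assms by (auto simp: tree_dist_def weight_def offset_def)

lemma tree_dist_commute: "tree_dist u w = tree_dist w u"
  by (simp add: tree_dist_def abs_minus_commute)

lemma tree_dist_pos:
  assumes "u \<noteq> w" shows "1 \<le> tree_dist u w"
proof (cases "u \<in> spine \<and> w \<in> spine")
  case True
  hence "pos u \<noteq> pos w" using assms v_pos by metis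
  thus ?thesis using assms by (simp add: tree_dist_def)
next
  case False
  hence "1 \<le> leg u + leg w" by (auto simp: leg_def)
  hence "1 \<le> int (leg u) + int (leg w)" by linarith
  thus ?thesis using assms by (simp add: tree_dist_def)
qed

lemma tree_dist_le_diameter:
  assumes "u \<in> pverts G" "w \<in> pverts G"
  shows "tree_dist u w \<le> int (m - 1)"
proof -
  \<comment> \<open>A leg hangs at least one step inside either end of the spine, which makes up for
    its own edge.\<close>
  have "1 + leg x \<le> pos x \<and> pos x + leg x \<le> m" if "x \<in> pverts G" for x
    using leg_pos[OF that] pos_range[OF that] by (auto simp: leg_def)
  from this[OF assms(1)] this[OF assms(2)] show ?thesis
    by (auto simp: tree_dist_def)
qed

lemma weight_add_ge_2:
  assumes "u \<noteq> w"
  shows "2 \<le> weight u + weight w"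
  using tree_dist_pos[OF assms] tree_dist_le_weight[of u w] by linarith

text \<open>The positions that carry legs form a centered interval of length \<open>m - 2\<close>,
  so \<open>sum_centered_abs\<close> applies to the spine and to the legs, with the same parity.
  Each leg adds a further 2.\<close>

lemma sum_weight:
  "2 * sum weight (pverts G)
    = (int m)\<^sup>2 - int (m mod 2) + (int k - 2) * ((int m)\<^sup>2 - 4 - int (m mod 2))"
proof -
  define m' where "m' = m - 2"
  have m': "m - 1 = Suc m'" "int m = int m' + 2" and k': "int (k - 2) = int k - 2"
    using m_ge_3 k by (auto simp: m'_def)
  define T where "T = (\<lambda>n. \<Sum>i=1..n. \<bar>2 * int i - (int n + 1)\<bar>)"
  have T: "2 * T n = (int n)\<^sup>2 - int (n mod 2)" for n
    unfolding T_def by (rule sum_centered_abs)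
  have "sum weight (pverts G) = (\<Sum>u\<in>pverts G. \<bar>2 * int (pos u) - (int m + 1)\<bar> + 2 * int (leg u))"
    by (simp add: weight_def offset_def)
  also have "\<dots> = T m + int (k - 2) * (\<Sum>i=2..m-1. \<bar>2 * int i - (int m + 1)\<bar> + 2)"
    unfolding T_def
    using sum_over_verts[of "\<lambda>i l. \<bar>2 * int i - (int m + 1)\<bar> + 2 * int l"] by simp
  also have "(\<Sum>i=2..m-1. \<bar>2 * int i - (int m + 1)\<bar> + 2)
      = (\<Sum>i=Suc 1..Suc m'. \<bar>2 * int i - (int m + 1)\<bar> + 2)"
    unfolding m'(1) by (simp add: numeral_2_eq_2)
  also have "\<dots> = (\<Sum>i=1..m'. \<bar>2 * int i - (int m' + 1)\<bar> + 2)"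
    unfolding sum.shift_bounds_cl_Suc_ivl m'(2) by (intro sum.cong) auto
  also have "\<dots> = T m' + 2 * int m'"
    by (simp add: T_def sum.distrib)
  finally have sum: "2 * sum weight (pverts G) = 2 * T m + (int k - 2) * (2 * T m' + 4 * int m')"
    unfolding k' by (simp add: algebra_simps)
  have "m' mod 2 = m mod 2"
    using m_ge_3 by (auto simp: m'_def mod_2_eq_odd)
  moreover have int_m': "int m' = int m - 2" using m'(2) by simp
  ultimately have T_m': "2 * T m' = (int m - 2)\<^sup>2 - int (m mod 2)" by (simp only: T)
  show ?thesis
    unfolding sum T_m' T[of m] int_m' by (simp add: power2_eq_square algebra_simps)
qed

text \<open>The reflection of position \<open>i\<close> to \<open>m + 1 - i\<close> exchanges the
  sides. It preserves both \<open>{1..m}\<close> and \<open>{2..m-1}\<close>, the ranges of spine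
  vertices and of legs.\<close>

lemma card_offset_sides:
  "card {u \<in> pverts G. 0 < offset u} = card {u \<in> pverts G. offset u < 0}"
proof -
  let ?F = "\<lambda>i _. if 2 * int i - (int m + 1) > 0 then 1 else 0 :: nat"
  let ?F' = "\<lambda>i _. if 2 * int i - (int m + 1) < 0 then 1 else 0 :: nat"
  have rev: "(\<Sum>i=a..b. ?F i l) = (\<Sum>i=a..b. ?F' i l)" if "a + b = m + 1" for a b l :: nat
  proof -
    have "(\<Sum>i=a..b. ?F i l) = (\<Sum>i=a..b. ?F (b + a - i) l)"
      by (rule sum.atLeastAtMost_rev)
    also have "\<dots> = (\<Sum>i=a..b. ?F' i l)"
    proof (rule sum.cong)
      fix i assume "i \<in> {a..b}"
      hence "int (b + a - i) = int m + 1 - int i" using that by auto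
      thus "?F (b + a - i) l = ?F' i l" by auto
    qed simp
    finally show ?thesis .
  qed
  have "card {u \<in> pverts G. 0 < offset u} = (\<Sum>u\<in>pverts G. ?F (pos u) (leg u))"
    using pair_finite_verts by (simp add: offset_def sum.If_cases Int_def)
  also have "\<dots> = (\<Sum>u\<in>pverts G. ?F' (pos u) (leg u))"
    unfolding sum_over_verts[of ?F] sum_over_verts[of ?F']
    using rev[of 1 m] rev[of 2 "m - 1"] m_ge_3 by simp
  also have "\<dots> = card {u \<in> pverts G. offset u < 0}"
    using pair_finite_verts by (simp add: offset_def sum.If_cases Int_def)
  finally show ?thesis .
qed

text \<open>For odd \<open>m\<close> the ends are the central spine vertex, of weight 0, and one of
  its legs, of weight 2. For even \<open>m\<close> they are the two middle spine vertices, each of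
  weight 1.\<close>

lemma optimal_enumeration:
  obtains xs where "distinct xs" "set xs = pverts G" "weight (hd xs) + weight (last xs) = 2"
    "successively (\<lambda>u w. offset u \<le> 0 \<and> 0 \<le> offset w \<or> offset w \<le> 0 \<and> 0 \<le> offset u) xs"
proof -
  let ?R = "\<lambda>u w. offset u \<le> 0 \<and> 0 \<le> offset w \<or> offset w \<le> 0 \<and> 0 \<le> offset u"
  let ?P = "{u \<in> pverts G. 0 < offset u}" and ?N = "{u \<in> pverts G. offset u < 0}"
  note fin = pair_finite_verts
  show thesis
  proof (cases "odd m")
    case True
    then obtain r where r: "m = 2 * r + 1" by (elim oddE)
    define w where "w = v (r + 1)"
    define Z where "Z = {u \<in> pverts G. offset u = 0} - {w}"
    have r': "int m = 2 * int r + 1" and range: "r + 1 \<in> {1..m}" "r + 1 \<in> {2..m-1}"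
      using r m_ge_3 by auto
    have w: "w \<in> pverts G" "w \<in> spine" "offset w = 0" "leg w = 0"
      unfolding w_def offset_def r' using range(1) by simp_all
    \<comment> \<open>Here \<open>k \<ge> 3\<close> supplies a leg at the center for the end of the
      list.\<close>
    have "card (legs_at (r + 1)) \<noteq> 0"
      using card_legs_at[OF range(2)] k by simp
    hence "legs_at (r + 1) \<noteq> {}" by auto
    moreover have "legs_at (r + 1) \<subseteq> Z"
      using w(2) r' by (auto simp: legs_at_def Z_def offset_def)
    ultimately have "Z \<noteq> {}" by blast
    have "\<exists>xs. distinct xs \<and> set xs = insert w (?P \<union> ?N \<union> Z) \<and> successively ?R xs \<and>
        hd xs = w \<and> last xs \<in> Z"
      by (rule alternating_enumeration)
        (use fin w card_offset_sides \<open>Z \<noteq> {}\<close> in \<open>auto simp: Z_def\<close>)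
    then obtain xs where xs: "distinct xs" "set xs = insert w (?P \<union> ?N \<union> Z)" "successively ?R xs"
        "hd xs = w" "last xs \<in> Z"
      by blast
    have "leg u = 1" if "u \<in> Z" for u
    proof -
      have "pos u = r + 1" using that r' by (auto simp: Z_def offset_def)
      hence "v (pos u) \<noteq> u" using that by (auto simp: Z_def w_def)
      hence "u \<notin> spine" using v_pos by blast
      thus ?thesis by (simp add: leg_def)
    qed
    hence "leg (last xs) = 1" using xs(5) by blast
    moreover have "offset (last xs) = 0" using xs(5) unfolding Z_def by blast
    ultimately have "weight (hd xs) + weight (last xs) = 2"
      unfolding weight_def xs(4) using w by simp
    moreover have "pverts G = insert w (?P \<union> ?N \<union> Z)"
      using w(1) unfolding Z_def by (auto simp: neq_iff)
    hence "set xs = pverts G" using xs(2) by simp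
    ultimately show thesis using that[OF xs(1) _ _ xs(3)] by simp
  next
    case False
    then obtain r where r: "m = 2 * r" by (auto elim: evenE)
    define w z where "w = v r" and "z = v (r + 1)"
    have r': "int m = 2 * int r" and range: "r \<in> {1..m}" "r + 1 \<in> {1..m}"
      using r m_ge_3 by auto
    have w: "w \<in> pverts G" "offset w = -1" "leg w = 0"
      unfolding w_def offset_def r' using range(1) by simp_all
    have z: "z \<in> pverts G" "offset z = 1" "leg z = 0"
      unfolding z_def offset_def r' using range(2) by simp_all
    have "offset u \<noteq> 0" for u unfolding offset_def r' by presburger
    \<comment> \<open>Each side gives up one middle vertex for an end of the list, so the remaining
      sides still have equal size.\<close>
    hence verts: "pverts G = insert w ((?P - {z}) \<union> (?N - {w}) \<union> {z})"
      using w z by (auto simp: neq_iff)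
    have "\<exists>xs. distinct xs \<and> set xs = insert w ((?P - {z}) \<union> (?N - {w}) \<union> {z}) \<and>
        successively ?R xs \<and> hd xs = w \<and> last xs \<in> {z}"
      by (rule alternating_enumeration) (use fin w z card_offset_sides in auto)
    then obtain xs where xs: "distinct xs" "set xs = insert w ((?P - {z}) \<union> (?N - {w}) \<union> {z})"
        "successively ?R xs" "hd xs = w" "last xs \<in> {z}"
      by blast
    have "weight (hd xs) + weight (last xs) = 2"
      using xs(4,5) w z by (auto simp: weight_def)
    thus thesis using that[OF xs(1) _ _ xs(3)] xs(2) verts by simp
  qed
qed

section \<open>The value of the hamiltonian chromatic number\<close>

lemma hamiltonian_chromatic_number_eq:
  "int (hamiltonian_chromatic_number G)
    = ((int m - 2) * (int k - 1) + 1)\<^sup>2 - sum weight (pverts G) + 1"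
proof -
  let ?n = "(m - 2) * (k - 1) + 1"
  obtain xs where xs: "distinct xs" "set xs = pverts G" "weight (hd xs) + weight (last xs) = 2"
    "successively (\<lambda>u w. offset u \<le> 0 \<and> 0 \<le> offset w \<or> offset w \<le> 0 \<and> 0 \<le> offset u) xs"
    by (rule optimal_enumeration)
  \<comment> \<open>From \<open>k \<ge> 3\<close> follows \<open>2 * (m - 2) + 1 \<le> ?n\<close>,
    which is the required bound for the diameter \<open>m - 1\<close>.\<close>
  have "(m - 2) * 2 \<le> (m - 2) * (k - 1)" using k by (intro mult_left_mono) auto
  hence diameter: "2 * (m - 1) \<le> Suc ?n" using m_ge_3 by linarith
  have ends: "weight (hd xs) + weight (last xs) \<le> weight u + weight w" if "u \<noteq> w" for u w
    using weight_add_ge_2[OF that] xs(3) by simp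
  have alternating: "successively (\<lambda>u w. 2 * int (detour_distance G u w) = weight u + weight w) xs"
    unfolding successively_conv_nth
  proof (intro allI impI)
    fix i assume i: "Suc i < length xs"
    hence "xs ! i \<noteq> xs ! Suc i" using xs(1) by (simp add: nth_eq_iff_index_eq)
    moreover have "xs ! i \<in> pverts G" "xs ! Suc i \<in> pverts G"
      using i xs(2) nth_mem[of i xs] nth_mem[of "Suc i" xs] by auto
    ultimately show "2 * int (detour_distance G (xs ! i) (xs ! Suc i))
        = weight (xs ! i) + weight (xs ! Suc i)"
      using successively_nth[OF xs(4) i] by (simp add: detour_distance_eq tree_dist_eq_weight)
  qed
  have hc: "2 * int (hamiltonian_chromatic_number G)
      = 2 * (int ?n)\<^sup>2 - 2 * sum weight (pverts G) + weight (hd xs) + weight (last xs)"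
  proof (rule hamiltonian_chromatic_number_eqI[OF pair_finite_verts card_verts diameter _ _ _ _ _ _
        xs(1,2) alternating])
    fix u w assume uw: "u \<in> pverts G" "w \<in> pverts G"
    note D = detour_distance_eq[OF uw]
    show "detour_distance G u w = detour_distance G w u"
      using D detour_distance_eq[OF uw(2,1)] tree_dist_commute[of u w] by simp
    assume "u \<noteq> w"
    show "weight (hd xs) + weight (last xs) \<le> weight u + weight w"
      using ends[OF \<open>u \<noteq> w\<close>] .
    show "detour_distance G u w \<le> m - 1" "1 \<le> detour_distance G u w"
      "2 * int (detour_distance G u w) \<le> weight u + weight w"
      using D tree_dist_le_diameter[OF uw] tree_dist_pos[OF \<open>u \<noteq> w\<close>] tree_dist_le_weight[of u w]
      by linarith+
  qed simp
  have n: "int ?n = (int m - 2) * (int k - 1) + 1"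
    using m_ge_3 k by (simp add: of_nat_diff)
  show ?thesis using hc[unfolded n] xs(3) by linarith
qed

end

theorem theorem8:
  fixes G :: "'a pair_pre_digraph" and v :: "nat \<Rightarrow> 'a" and m k :: nat
  assumes "m \<ge> 3" and "k \<ge> 3"
    and "regular_caterpillar G m k v"
  shows "real (hamiltonian_chromatic_number G) =
    (if odd m
     then (real m - 2)^2 * (real k)^2
            - 1/2 * (5 * (real m)^2 - 20 * real m + 19) * real k
            + 1/2 * (3 * (real m)^2 - 12 * real m + 11)
     else (real m - 2)^2 * (real k)^2
            - 1/2 * (5 * (real m)^2 - 20 * real m + 20) * real k
            + 1/2 * (3 * (real m)^2 - 12 * real m + 12))"
proof -
  interpret regular_caterpillar_graph G m v k
    using assms by unfold_locales (auto simp: regular_caterpillar_def)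
  \<comment> \<open>The parity term keeps both cases in one formula until the last step.\<close>
  define e where "e = int (m mod 2)"
  have "2 * int (hamiltonian_chromatic_number G)
      = 2 * ((int m - 2) * (int k - 1) + 1)\<^sup>2
        - ((int m)\<^sup>2 - e + (int k - 2) * ((int m)\<^sup>2 - 4 - e)) + 2"
    using hamiltonian_chromatic_number_eq sum_weight by (simp add: e_def)
  hence "real_of_int (2 * int (hamiltonian_chromatic_number G))
      = real_of_int (2 * ((int m - 2) * (int k - 1) + 1)\<^sup>2
        - ((int m)\<^sup>2 - e + (int k - 2) * ((int m)\<^sup>2 - 4 - e)) + 2)"
    by (simp only:)
  hence "2 * real (hamiltonian_chromatic_number G)
      = 2 * ((real m - 2) * (real k - 1) + 1)\<^sup>2
        - ((real m)\<^sup>2 - of_int e + (real k - 2) * ((real m)\<^sup>2 - 4 - of_int e)) + 2"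
    by simp
  moreover have "e = (if odd m then 1 else 0)"
    by (simp add: e_def odd_iff_mod_2_eq_one)
  ultimately show ?thesis
    by (cases "odd m") (simp_all add: power2_eq_square field_simps)
qed

end
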